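(* Let $m,n\ge 1$ be integers, and suppose that $q_m$ and $q_n$ are coprime, where $q_k=(k+1)^k-1$. Let $\Gamma_{m,n}=Q_m*Q_n$, with presentation $$\Gamma_{m,n}=\langle x_m,t_m,x_n,t_n \mid \rho_m(x_m,t_m),\ \rho_n(x_n,t_n),\ x_m^{m},\ x_n^{n}\rangle,$$ where $x_m,t_m,x_n,t_n$ denote four distinct generators. Let $F$ be the free group on these four generators, let $R$ be the normal closure in $F$ of the four relators (so $\Gamma_{m,n}=F/R$), and let $R_{\mathrm{ab}}=R/[R,R]$ be the relation module of this presentation. Then $R_{\mathrm{ab}}$ is generated as a $\mathbf{Z}\Gamma_{m,n}$-module by the images of the three elements $\rho_m(x_m,t_m)$, $\rho_n(x_n,t_n)$ and $x_m^{m}x_n^{n}$ of $R$.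
   Context: For letters $x,t$ and an integer $k\ge1$, $\rho_k(x,t)$ denotes the word $(txt^{-1})\,x\,(txt^{-1})^{-1}x^{-k-1}$, and $Q_k$ is the group $\langle x,t\mid \rho_k(x,t),\,x^{k}\rangle$. For a presentation $\Gamma=F/R$ with $F$ free and $R$ normal in $F$, the conjugation action of $F$ on $R$ induces an action of $\Gamma$ on $R_{\mathrm{ab}}=R/[R,R]$, making it a $\mathbf{Z}\Gamma$-module, called the relation module of the presentation. *)

theory Defs
  imports "HOL-Algebra.Algebra"
begin

section \<open>Free groups\<close>

text \<open>
  The letter \<open>(g, True)\<close> stands for the generator \<open>g\<close> and \<open>(g, False)\<close> for its formal inverse.
  If \<open>v\<close> is reduced, \<open>foldr push_letter u v\<close> is the reduced form of the concatenation \<open>u @ v\<close>.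
\<close>

type_synonym 'g letter = "'g \<times> bool"

definition inv_letter :: "'g letter \<Rightarrow> 'g letter" where
  "inv_letter a = (fst a, \<not> snd a)"

definition reduced :: "'g letter list \<Rightarrow> bool" where
  "reduced = successively (\<lambda>a b. b \<noteq> inv_letter a)"

fun push_letter :: "'g letter \<Rightarrow> 'g letter list \<Rightarrow> 'g letter list" where
  "push_letter a [] = [a]"
| "push_letter a (b # w) = (if b = inv_letter a then w else a # b # w)"

definition free_group :: "'g letter list monoid" where
  "free_group = \<lparr>carrier = Collect reduced, monoid.mult = foldr push_letter, one = []\<rparr>"

definition free_gen :: "'g \<Rightarrow> 'g letter list" where
  "free_gen g = [(g, True)]"

lemma inv_letter_inv_letter [simp]: "inv_letter (inv_letter a) = a"
  by (simp add: inv_letter_def)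

lemma inv_letter_neq [simp]: "inv_letter a \<noteq> a" "a \<noteq> inv_letter a"
  by (simp_all add: inv_letter_def prod_eq_iff)

lemma inv_letter_eq_iff [simp]: "inv_letter a = inv_letter b \<longleftrightarrow> a = b"
  by (metis inv_letter_inv_letter)

lemma reduced_Nil [simp]: "reduced []"
  by (simp add: reduced_def)

lemma reduced_Cons: "reduced (a # w) \<longleftrightarrow> reduced w \<and> (w = [] \<or> hd w \<noteq> inv_letter a)"
  by (cases w) (auto simp: reduced_def)

lemma reduced_push_letter: "reduced w \<Longrightarrow> reduced (push_letter a w)"
  by (cases w) (auto simp: reduced_Cons)

lemma reduced_foldr_push: "reduced w \<Longrightarrow> reduced (foldr push_letter u w)"
  by (induction u) (auto simp: reduced_push_letter)

lemma push_push_inv: "reduced w \<Longrightarrow> push_letter a (push_letter (inv_letter a) w) = w"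
  by (cases w; cases "tl w") (auto simp: reduced_Cons)

lemma foldr_push_push:
  assumes "reduced w"
  shows "foldr push_letter (push_letter a z) w = push_letter a (foldr push_letter z w)"
  using assms by (cases z) (auto simp: push_push_inv reduced_foldr_push)

lemma foldr_push_assoc:
  assumes "reduced w"
  shows "foldr push_letter (foldr push_letter u v) w = foldr push_letter u (foldr push_letter v w)"
  using assms by (induction u) (auto simp: foldr_push_push)

lemma foldr_push_Nil: "reduced u \<Longrightarrow> foldr push_letter u [] = u"
proof (induction u)
  case (Cons a u)
  then show ?case by (cases u) (auto simp: reduced_Cons)
qed simp

lemma foldr_push_left_inverse: "foldr push_letter (map inv_letter (rev u)) u = []"
  by (induction u) auto

lemma reduced_map_rev:
  assumes "reduced u"
  shows "reduced (map inv_letter (rev u))"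
  using assms unfolding reduced_def
  by (simp add: successively_map) (erule successively_mono, auto)

lemma group_free_group: "group (free_group :: 'g letter list monoid)"
proof (rule groupI)
  fix u :: "'g letter list" assume "u \<in> carrier free_group"
  then show "\<exists>v\<in>carrier free_group. v \<otimes>\<^bsub>free_group\<^esub> u = \<one>\<^bsub>free_group\<^esub>"
    by (intro bexI[of _ "map inv_letter (rev u)"])
      (auto simp: free_group_def foldr_push_left_inverse reduced_map_rev)
qed (auto simp: free_group_def reduced_foldr_push foldr_push_assoc)

lemma free_gen_closed: "free_gen g \<in> carrier free_group"
  by (simp add: free_group_def free_gen_def reduced_def)

theorem (in group) free_group_universal:
  assumes f: "\<And>g. f g \<in> carrier G"
  shows "\<exists>h \<in> hom free_group G. \<forall>g. h (free_gen g) = f g"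
proof -
  define l where "l a = (if snd a then f (fst a) else inv (f (fst a)))" for a :: "'c letter"
  define h where "h w = foldr (\<lambda>a y. l a \<otimes> y) w \<one>" for w
  have l [simp]: "l a \<in> carrier G" for a using f by (simp add: l_def)
  have l_inv: "l a \<otimes> l (inv_letter a) = \<one>" for a
    using f by (simp add: l_def inv_letter_def)
  have h [simp]: "h w \<in> carrier G" for w by (induction w) (auto simp: h_def)
  have h_Cons: "h (a # w) = l a \<otimes> h w" for a w by (simp add: h_def)
  have h_push: "h (push_letter a w) = l a \<otimes> h w" for a w
    by (cases w) (auto simp: h_Cons m_assoc [symmetric] l_inv)
  have "h (foldr push_letter u v) = h u \<otimes> h v" for u v
    by (induction u) (auto simp: h_push h_Cons m_assoc, simp add: h_def)
  then have "h \<in> hom free_group G" by (auto simp: hom_def free_group_def)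
  moreover have "h (free_gen g) = f g" for g
    using f by (simp add: h_def free_gen_def l_def)
  ultimately show ?thesis by blast
qed

lemma free_group_generated: "generate free_group (range free_gen) = carrier free_group"
proof -
  interpret F: group free_group by (rule group_free_group)
  have sub: "range free_gen \<subseteq> carrier free_group" by (auto simp: free_gen_closed)
  have letter: "[a] \<in> generate free_group (range free_gen)" for a :: "'a letter"
  proof (cases a)
    case (Pair g b)
    have "[(g, False)] \<otimes>\<^bsub>free_group\<^esub> free_gen g = \<one>\<^bsub>free_group\<^esub>"
      by (simp add: free_group_def free_gen_def inv_letter_def)
    then have "inv\<^bsub>free_group\<^esub> free_gen g = [(g, False)]"
      by (rule F.inv_equality) (auto simp: free_gen_closed, simp add: free_group_def reduced_def)
    then show ?thesis
      using Pair generate.incl[of "free_gen g" "range free_gen" free_group]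
        generate.inv[of "free_gen g" "range free_gen" free_group]
      by (cases b) (auto simp: free_gen_def)
  qed
  have "w \<in> generate free_group (range free_gen)" if "reduced w" for w :: "'a letter list"
    using that
  proof (induction w)
    case Nil
    show ?case using generate.one[of free_group] by (simp add: free_group_def)
  next
    case (Cons a w)
    then have "[a] \<otimes>\<^bsub>free_group\<^esub> w \<in> generate free_group (range free_gen)"
      using generate.eng[OF letter] by (auto simp: reduced_Cons)
    moreover have "[a] \<otimes>\<^bsub>free_group\<^esub> w = a # w"
      using Cons.prems by (cases w) (auto simp: free_group_def reduced_Cons)
    ultimately show ?case by simp
  qed
  then show ?thesis
    using F.generate_incl[OF sub] by (auto simp: free_group_def)
qed

definition normal_closure :: "('a, 'b) monoid_scheme \<Rightarrow> 'a set \<Rightarrow> 'a set" where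
  "normal_closure G S = (\<lambda>N. N \<lhd> G) hull S"

lemma (in group) normal_closure_normal:
  assumes "S \<subseteq> carrier G"
  shows "normal_closure G S \<lhd> G"
proof -
  let ?A = "{N. N \<lhd> G \<and> S \<subseteq> N}"
  have "carrier G \<in> ?A" using assms normal_self by auto
  then have "subgroup (\<Inter> ?A) G"
    by (intro subgroups_Inter) (auto intro: normal_imp_subgroup)
  then show ?thesis
    unfolding normal_closure_def hull_def normal_inv_iff
    by (auto simp: normal_inv_iff[symmetric] intro: normal.inv_op_closed2)
qed

section \<open>Integral group rings and left modules\<close>

definition group_ring :: "('a, 'b) monoid_scheme \<Rightarrow> ('a \<Rightarrow>\<^sub>0 int) ring" where
  "group_ring G = \<lparr>carrier = {u. Poly_Mapping.keys u \<subseteq> carrier G},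
     monoid.mult = (\<lambda>u v. frag_extend (\<lambda>a. frag_extend (\<lambda>b. frag_of (a \<otimes>\<^bsub>G\<^esub> b)) v) u),
     one = frag_of \<one>\<^bsub>G\<^esub>, ring.zero = 0, ring.add = (+)\<rparr>"

text \<open>
  The library locale \<open>module\<close> requires a commutative ring of scalars; its record type and the locale
  \<open>submodule\<close> do not.
\<close>

locale left_module = R?: ring R + M?: abelian_group M
  for R :: "('r, 'c) ring_scheme" (structure) and M :: "('r, 'm, 'd) module_scheme" (structure) +
  assumes smult_closed:
      "\<lbrakk>a \<in> carrier R; x \<in> carrier M\<rbrakk> \<Longrightarrow> a \<odot>\<^bsub>M\<^esub> x \<in> carrier M"
    and smult_l_distr:
      "\<lbrakk>a \<in> carrier R; b \<in> carrier R; x \<in> carrier M\<rbrakk> \<Longrightarrow>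
       (a \<oplus> b) \<odot>\<^bsub>M\<^esub> x = a \<odot>\<^bsub>M\<^esub> x \<oplus>\<^bsub>M\<^esub> b \<odot>\<^bsub>M\<^esub> x"
    and smult_r_distr:
      "\<lbrakk>a \<in> carrier R; x \<in> carrier M; y \<in> carrier M\<rbrakk> \<Longrightarrow>
       a \<odot>\<^bsub>M\<^esub> (x \<oplus>\<^bsub>M\<^esub> y) = a \<odot>\<^bsub>M\<^esub> x \<oplus>\<^bsub>M\<^esub> a \<odot>\<^bsub>M\<^esub> y"
    and smult_assoc:
      "\<lbrakk>a \<in> carrier R; b \<in> carrier R; x \<in> carrier M\<rbrakk> \<Longrightarrow>
       (a \<otimes> b) \<odot>\<^bsub>M\<^esub> x = a \<odot>\<^bsub>M\<^esub> (b \<odot>\<^bsub>M\<^esub> x)"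
    and smult_one: "x \<in> carrier M \<Longrightarrow> \<one> \<odot>\<^bsub>M\<^esub> x = x"

definition submodule_span ::
  "('r, 'c) ring_scheme \<Rightarrow> ('r, 'm, 'd) module_scheme \<Rightarrow> 'm set \<Rightarrow> 'm set" where
  "submodule_span R M S = (\<lambda>N. submodule N R M) hull S"

lemma (in left_module) submodule_submodule_span:
  assumes "S \<subseteq> carrier M"
  shows "submodule (submodule_span R M S) R M"
proof -
  let ?A = "{N. submodule N R M \<and> S \<subseteq> N}"
  have add_group: "group (add_monoid M)"
    using M.a_comm_group by (simp add: comm_group_def)
  have "submodule (carrier M) R M"
    using group.subgroup_self[OF add_group] smult_closed
    by (simp add: submodule_def submodule_axioms_def)
  then have "subgroup (\<Inter> ?A) (add_monoid M)"
    using assms by (intro group.subgroups_Inter[OF add_group]) (auto simp: submodule_def)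
  then show ?thesis
    by (auto simp: submodule_span_def hull_def submodule_def submodule_axioms_def)
qed

lemma keys_frag_extend_subset:
  assumes "\<And>a. a \<in> Poly_Mapping.keys u \<Longrightarrow> Poly_Mapping.keys (f a) \<subseteq> S"
  shows "Poly_Mapping.keys (frag_extend f u) \<subseteq> S"
  using keys_frag_extend[of f u] assms by blast

lemma frag_extend_fun_add:
  "frag_extend (\<lambda>a. f a + g a) u = frag_extend f u + frag_extend g u"
  by (simp add: frag_extend_def frag_cmul_distrib2 sum.distrib)

lemma (in group) ring_group_ring: "ring (group_ring G)"
proof (rule ringI)
  let ?R = "group_ring G"
  show "abelian_group ?R"
  proof (rule abelian_groupI)
    fix u assume "u \<in> carrier ?R"
    then show "\<exists>v\<in>carrier ?R. v \<oplus>\<^bsub>?R\<^esub> u = \<zero>\<^bsub>?R\<^esub>"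
      by (intro bexI[of _ "- u"]) (auto simp: group_ring_def)
  qed (use keys_add in \<open>fastforce simp: group_ring_def ac_simps\<close>)+
  define mul where "mul u v = frag_extend (\<lambda>a. frag_extend (\<lambda>b. frag_of (a \<otimes> b)) v) u" for u v
  have mult: "u \<otimes>\<^bsub>?R\<^esub> v = mul u v" for u v
    by (simp add: group_ring_def mul_def)
  have closed: "Poly_Mapping.keys (mul u v) \<subseteq> carrier G"
    if "Poly_Mapping.keys u \<subseteq> carrier G" "Poly_Mapping.keys v \<subseteq> carrier G" for u v
    unfolding mul_def using that
    by (intro keys_frag_extend_subset) (auto simp: subset_iff)
  have left: "frag_extend (\<lambda>b. frag_of (\<one> \<otimes> b)) u = u" if "Poly_Mapping.keys u \<subseteq> carrier G" for u
  proof -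
    have "frag_extend (\<lambda>b. frag_of (\<one> \<otimes> b)) u = frag_extend frag_of u"
      using that by (intro frag_extend_eq) auto
    then show ?thesis by (simp add: frag_expansion[symmetric])
  qed
  have right: "frag_extend (\<lambda>b. frag_of (b \<otimes> \<one>)) u = u" if "Poly_Mapping.keys u \<subseteq> carrier G" for u
  proof -
    have "frag_extend (\<lambda>b. frag_of (b \<otimes> \<one>)) u = frag_extend frag_of u"
      using that by (intro frag_extend_eq) auto
    then show ?thesis by (simp add: frag_expansion[symmetric])
  qed
  have diff: "mul (u - v) w = mul u w - mul v w" for u v w
    by (simp add: mul_def frag_extend_diff)
  have assoc2: "mul (frag_extend (\<lambda>b. frag_of (a \<otimes> b)) v) w
      = frag_extend (\<lambda>b. frag_of (a \<otimes> b)) (mul v w)"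
    if a: "a \<in> carrier G" and v: "Poly_Mapping.keys v \<subseteq> carrier G"
      and w: "Poly_Mapping.keys w \<subseteq> carrier G" for a v w
    using v
  proof (induction v rule: frag_induction)
    case (one b)
    have "frag_extend (\<lambda>c. frag_of (a \<otimes> c)) (frag_extend (\<lambda>c. frag_of (b \<otimes> c)) w)
        = frag_extend (\<lambda>c. frag_of (a \<otimes> (b \<otimes> c))) w"
      using frag_extend_compose[of "\<lambda>c. frag_of (a \<otimes> c)" "\<lambda>c. b \<otimes> c" w] by (simp add: comp_def)
    also have "\<dots> = frag_extend (\<lambda>c. frag_of (a \<otimes> b \<otimes> c)) w"
      using a one w by (intro frag_extend_eq) (auto simp: m_assoc)
    finally show ?case by (simp add: mul_def)
  qed (simp_all add: diff frag_extend_diff, simp add: mul_def)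
  have assoc: "mul (mul u v) w = mul u (mul v w)"
    if u: "Poly_Mapping.keys u \<subseteq> carrier G" and v: "Poly_Mapping.keys v \<subseteq> carrier G"
      and w: "Poly_Mapping.keys w \<subseteq> carrier G" for u v w
    using u
  proof (induction u rule: frag_induction)
    case (one a)
    then show ?case using assoc2[OF _ v w] by (simp add: mul_def)
  qed (simp_all add: diff, simp add: mul_def)
  show "Group.monoid ?R"
  proof (rule monoidI)
    show "u \<otimes>\<^bsub>?R\<^esub> v \<in> carrier ?R" if "u \<in> carrier ?R" "v \<in> carrier ?R" for u v
      using that closed[of u v] unfolding mult by (simp add: group_ring_def)
    show "u \<otimes>\<^bsub>?R\<^esub> v \<otimes>\<^bsub>?R\<^esub> w = u \<otimes>\<^bsub>?R\<^esub> (v \<otimes>\<^bsub>?R\<^esub> w)"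
      if "u \<in> carrier ?R" "v \<in> carrier ?R" "w \<in> carrier ?R" for u v w
      using that assoc[of u v w] unfolding mult by (simp add: group_ring_def)
  qed (simp_all add: group_ring_def left right)
  show "(u \<oplus>\<^bsub>?R\<^esub> v) \<otimes>\<^bsub>?R\<^esub> w = u \<otimes>\<^bsub>?R\<^esub> w \<oplus>\<^bsub>?R\<^esub> v \<otimes>\<^bsub>?R\<^esub> w" for u v w
    by (simp add: group_ring_def frag_extend_add)
  show "w \<otimes>\<^bsub>?R\<^esub> (u \<oplus>\<^bsub>?R\<^esub> v) = w \<otimes>\<^bsub>?R\<^esub> u \<oplus>\<^bsub>?R\<^esub> w \<otimes>\<^bsub>?R\<^esub> v" for u v w
    by (simp add: group_ring_def frag_extend_add frag_extend_fun_add)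
qed

section \<open>Relation modules\<close>

text \<open>
  Elements of \<open>F Mod N\<close> and of the abelianisation of \<open>N\<close> are cosets, that is, subsets of \<open>F\<close>.  A coset
  \<open>C\<close> of \<open>N\<close> acts on a coset \<open>A\<close> of \<open>[N, N]\<close> by conjugating all elements of \<open>A\<close> by all elements of
  \<open>C\<close>: this is the coset of \<open>g a g\<inverse>\<close>, for any \<open>g \<in> C\<close> and \<open>a \<in> A\<close>, see \<open>coset_conj_rcos\<close> below.
\<close>

definition coset_conj :: "('a, 'b) monoid_scheme \<Rightarrow> 'a set \<Rightarrow> 'a set \<Rightarrow> 'a set" where
  "coset_conj F C A = (\<Union>g\<in>C. \<Union>a\<in>A. {g \<otimes>\<^bsub>F\<^esub> a \<otimes>\<^bsub>F\<^esub> inv\<^bsub>F\<^esub> g})"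

abbreviation abelianisation :: "('a, 'b) monoid_scheme \<Rightarrow> 'a set \<Rightarrow> 'a set monoid" where
  "abelianisation F N \<equiv> (F\<lparr>carrier := N\<rparr>) Mod (derived F N)"

definition relation_class :: "('a, 'b) monoid_scheme \<Rightarrow> 'a set \<Rightarrow> 'a \<Rightarrow> 'a set" where
  "relation_class F N r = derived F N #>\<^bsub>F\<^esub> r"

text \<open>
  The \<open>mult\<close> and \<open>one\<close> fields of the record play no role in a module and are left unspecified.
\<close>

definition relation_module ::
  "('a, 'b) monoid_scheme \<Rightarrow> 'a set \<Rightarrow> ('a set \<Rightarrow>\<^sub>0 int, 'a set) module" where
  "relation_module F N = \<lparr>carrier = carrier (abelianisation F N),
     monoid.mult = undefined, one = undefined,
     ring.zero = \<one>\<^bsub>abelianisation F N\<^esub>,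
     ring.add = (\<lambda>A B. A \<otimes>\<^bsub>abelianisation F N\<^esub> B),
     module.smult = (\<lambda>u A. \<Otimes>\<^bsub>abelianisation F N\<^esub>C\<in>Poly_Mapping.keys u.
       coset_conj F C A [^]\<^bsub>abelianisation F N\<^esub> Poly_Mapping.lookup u C)\<rparr>"

lemma (in group) carrier_abelianisation:
  "carrier (abelianisation G N) = (\<lambda>n. derived G N #> n) ` N"
  by (auto simp: FactGroup_def RCOSETS_def r_coset_def)

lemma (in group) mult_abelianisation:
  assumes N: "N \<lhd> G" and n: "n \<in> N" "n' \<in> N"
  shows "(derived G N #> n) \<otimes>\<^bsub>abelianisation G N\<^esub> (derived G N #> n') = derived G N #> (n \<otimes> n')"
proof -
  have "n \<in> carrier G" "n' \<in> carrier G"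
    using subgroup.mem_carrier[OF normal_imp_subgroup[OF N]] n by auto
  then have "(derived G N #> n) <#> (derived G N #> n') = derived G N #> (n \<otimes> n')"
    by (intro normal.rcos_sum derived_is_normal N)
  then show ?thesis
    by (simp add: FactGroup_def set_mult_def)
qed

lemma (in group) inv_cancel:
  assumes "a \<in> carrier G" "b \<in> carrier G"
  shows "a \<otimes> (inv a \<otimes> b) = b" "inv a \<otimes> (a \<otimes> b) = b"
  using assms by (simp_all add: m_assoc[symmetric])

lemma (in group) coset_conj_rcos:
  assumes N: "N \<lhd> G" and g: "g \<in> carrier G" and n: "n \<in> N"
  shows "coset_conj G (N #> g) (derived G N #> n) = derived G N #> (g \<otimes> n \<otimes> inv g)"
proof -
  let ?D = "derived G N"
  interpret N: normal N G by (rule N)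
  interpret D: normal ?D G by (rule derived_is_normal[OF N])
  have DN: "?D \<subseteq> N" by (intro derived_incl N.subgroup_axioms) simp
  have comm: "m \<otimes> k \<otimes> inv m \<otimes> inv k \<in> ?D" if "m \<in> N" "k \<in> N" for m k
    unfolding derived_def using that by (intro generate.incl) auto
  have nc: "n \<in> carrier G" using n by simp
  define k where "k = g \<otimes> n \<otimes> inv g"
  have k: "k \<in> N" unfolding k_def using g n by (rule N.inv_op_closed2)
  have "(m \<otimes> g) \<otimes> (d \<otimes> n) \<otimes> inv (m \<otimes> g) \<in> ?D #> k" if m: "m \<in> N" and d: "d \<in> ?D" for m d
  proof -
    have mc: "m \<in> carrier G" and dc: "d \<in> carrier G" and kc: "k \<in> carrier G"
      using m d k by auto
    define e where "e = m \<otimes> (g \<otimes> d \<otimes> inv g) \<otimes> inv m"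
    have e: "e \<in> ?D" unfolding e_def using g d mc by (intro D.inv_op_closed2)
    have "(m \<otimes> g) \<otimes> (d \<otimes> n) \<otimes> inv (m \<otimes> g) = e \<otimes> (m \<otimes> k \<otimes> inv m \<otimes> inv k) \<otimes> k"
      using mc dc nc g by (simp add: e_def k_def m_assoc inv_mult_group inv_cancel)
    moreover have "e \<otimes> (m \<otimes> k \<otimes> inv m \<otimes> inv k) \<in> ?D"
      using e comm[OF m k] by simp
    ultimately show ?thesis by (auto simp: r_coset_def)
  qed
  then have "coset_conj G (N #> g) (?D #> n) \<subseteq> ?D #> k"
    by (auto simp: coset_conj_def r_coset_def)
  moreover have "d \<otimes> k \<in> coset_conj G (N #> g) (?D #> n)" if d: "d \<in> ?D" for d
  proof -
    have dc: "d \<in> carrier G" using d by simp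
    have "inv g \<otimes> d \<otimes> g \<in> ?D" using g d by (rule D.inv_op_closed1)
    moreover have "\<one> \<otimes> g \<in> N #> g" by (auto simp: r_coset_def)
    moreover have "d \<otimes> k = (\<one> \<otimes> g) \<otimes> ((inv g \<otimes> d \<otimes> g) \<otimes> n) \<otimes> inv (\<one> \<otimes> g)"
      using dc nc g by (simp add: k_def m_assoc inv_cancel)
    ultimately show ?thesis
      unfolding coset_conj_def r_coset_def by blast
  qed
  ultimately show ?thesis
    unfolding k_def[symmetric] by (auto simp: r_coset_def)
qed

lemma (in comm_group) finprod_frag_add:
  fixes u v :: "'c \<Rightarrow>\<^sub>0 int"
  assumes f: "f \<in> S \<rightarrow> carrier G"
    and u: "Poly_Mapping.keys u \<subseteq> S" and v: "Poly_Mapping.keys v \<subseteq> S"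
  shows "(\<Otimes>c\<in>Poly_Mapping.keys (u + v). f c [^] Poly_Mapping.lookup (u + v) c)
    = (\<Otimes>c\<in>Poly_Mapping.keys u. f c [^] Poly_Mapping.lookup u c)
      \<otimes> (\<Otimes>c\<in>Poly_Mapping.keys v. f c [^] Poly_Mapping.lookup v c)"
proof -
  let ?K = "Poly_Mapping.keys u \<union> Poly_Mapping.keys v"
  have fK: "f c \<in> carrier G" if "c \<in> ?K" for c using f u v that by auto
  have ext: "(\<Otimes>c\<in>Poly_Mapping.keys w. f c [^] Poly_Mapping.lookup w c)
      = (\<Otimes>c\<in>?K. f c [^] Poly_Mapping.lookup w c)" if "Poly_Mapping.keys w \<subseteq> ?K" for w :: "'c \<Rightarrow>\<^sub>0 int"
  proof (rule finprod_mono_neutral_cong_left)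
    show "f i [^] Poly_Mapping.lookup w i = \<one>" if "i \<in> ?K - Poly_Mapping.keys w" for i
      using that fK[of i] by (simp add: not_in_keys_iff_lookup_eq_zero)
  qed (use that fK in auto)
  have "(\<Otimes>c\<in>Poly_Mapping.keys (u + v). f c [^] Poly_Mapping.lookup (u + v) c)
      = (\<Otimes>c\<in>?K. f c [^] Poly_Mapping.lookup (u + v) c)"
    by (rule ext) (rule keys_add)
  also have "\<dots> = (\<Otimes>c\<in>?K. f c [^] Poly_Mapping.lookup u c \<otimes> f c [^] Poly_Mapping.lookup v c)"
    using fK by (intro finprod_cong') (auto simp: lookup_add int_pow_mult simp del: in_keys_iff)
  also have "\<dots> = (\<Otimes>c\<in>?K. f c [^] Poly_Mapping.lookup u c) \<otimes> (\<Otimes>c\<in>?K. f c [^] Poly_Mapping.lookup v c)"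
    using fK by (intro finprod_multf) (auto simp del: in_keys_iff)
  finally show ?thesis by (simp add: ext)
qed

theorem (in group) left_module_relation_module:
  assumes N: "N \<lhd> G"
  shows "left_module (group_ring (G Mod N)) (relation_module G N)"
proof -
  let ?D = "derived G N" and ?A = "abelianisation G N" and ?Q = "G Mod N"
  let ?M = "relation_module G N" and ?R = "group_ring (G Mod N)"
  note mult_FactGroup [simp del] one_FactGroup [simp del]
  interpret N: normal N G by (rule N)
  interpret D: normal ?D G by (rule derived_is_normal[OF N])
  interpret A: comm_group ?A
    by (rule derived_quot_of_subgroup_is_comm_group) (rule N.subgroup_axioms)
  interpret Q: group ?Q by (rule N.factorgroup_is_group)
  interpret R: ring ?R by (rule Q.ring_group_ring)
  have Q_E: "\<exists>g\<in>carrier G. C = N #> g" if "C \<in> carrier ?Q" for C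
    using that by (auto simp: FactGroup_def RCOSETS_def)
  have A_E: "\<exists>n\<in>N. U = ?D #> n" if "U \<in> carrier ?A" for U
    using that by (auto simp: carrier_abelianisation)
  have A_I: "?D #> n \<in> carrier ?A" if "n \<in> N" for n
    using that by (auto simp: carrier_abelianisation)
  have conj_closed: "coset_conj G C U \<in> carrier ?A" if "C \<in> carrier ?Q" "U \<in> carrier ?A" for C U
    using Q_E[OF that(1)] A_E[OF that(2)] N
    by (auto simp: coset_conj_rcos intro!: A_I N.inv_op_closed2)
  have conj_mult: "coset_conj G C (U \<otimes>\<^bsub>?A\<^esub> V) = coset_conj G C U \<otimes>\<^bsub>?A\<^esub> coset_conj G C V"
    if C: "C \<in> carrier ?Q" and U: "U \<in> carrier ?A" and V: "V \<in> carrier ?A" for C U V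
  proof -
    obtain g x y where *: "g \<in> carrier G" "C = N #> g" "x \<in> N" "U = ?D #> x" "y \<in> N" "V = ?D #> y"
      using Q_E[OF C] A_E[OF U] A_E[OF V] by auto
    moreover have "g \<otimes> (x \<otimes> y) \<otimes> inv g = (g \<otimes> x \<otimes> inv g) \<otimes> (g \<otimes> y \<otimes> inv g)"
      using * by (simp add: m_assoc inv_cancel)
    ultimately show ?thesis
      by (simp add: mult_abelianisation[OF N] coset_conj_rcos[OF N] N.inv_op_closed2)
  qed
  have conj_conj: "coset_conj G (C \<otimes>\<^bsub>?Q\<^esub> C') U = coset_conj G C (coset_conj G C' U)"
    if C: "C \<in> carrier ?Q" and C': "C' \<in> carrier ?Q" and U: "U \<in> carrier ?A" for C C' U
  proof -
    obtain g h x where *: "g \<in> carrier G" "C = N #> g" "h \<in> carrier G" "C' = N #> h"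
        "x \<in> N" "U = ?D #> x"
      using Q_E[OF C] Q_E[OF C'] A_E[OF U] by auto
    moreover have "C \<otimes>\<^bsub>?Q\<^esub> C' = N #> (g \<otimes> h)"
      using * by (simp add: FactGroup_def N.rcos_sum)
    moreover have "(g \<otimes> h) \<otimes> x \<otimes> inv (g \<otimes> h) = g \<otimes> (h \<otimes> x \<otimes> inv h) \<otimes> inv g"
      using * by (simp add: m_assoc inv_mult_group)
    ultimately show ?thesis
      by (simp add: coset_conj_rcos[OF N] N.inv_op_closed2)
  qed
  have conj_one: "coset_conj G \<one>\<^bsub>?Q\<^esub> U = U" if U: "U \<in> carrier ?A" for U
  proof -
    obtain x where x: "x \<in> N" "U = ?D #> x" using A_E[OF U] by auto
    then have "coset_conj G (N #> \<one>) U = U"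
      by (simp add: coset_conj_rcos[OF N])
    moreover have "N #> \<one> = \<one>\<^bsub>?Q\<^esub>" by (simp add: FactGroup_def N.subset)
    ultimately show ?thesis by simp
  qed

  define sm where "sm u U = (\<Otimes>\<^bsub>?A\<^esub>C\<in>Poly_Mapping.keys u.
    coset_conj G C U [^]\<^bsub>?A\<^esub> Poly_Mapping.lookup u C)" for u :: "'a set \<Rightarrow>\<^sub>0 int" and U
  have sm_closed: "sm u U \<in> carrier ?A" if "Poly_Mapping.keys u \<subseteq> carrier ?Q" "U \<in> carrier ?A" for u U
    unfolding sm_def using that by (intro A.finprod_closed) (auto intro!: conj_closed)
  have sm_add: "sm (u + v) U = sm u U \<otimes>\<^bsub>?A\<^esub> sm v U"
    if "Poly_Mapping.keys u \<subseteq> carrier ?Q" "Poly_Mapping.keys v \<subseteq> carrier ?Q" "U \<in> carrier ?A" for u v U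
    unfolding sm_def using that by (intro A.finprod_frag_add) (auto intro!: conj_closed)
  have sm_0: "sm 0 U = \<one>\<^bsub>?A\<^esub>" for U
    by (simp add: sm_def)
  have sm_of: "sm (frag_of C) U = coset_conj G C U" if "C \<in> carrier ?Q" "U \<in> carrier ?A" for C U
    using that by (simp add: sm_def conj_closed)
  have sm_diff: "sm (u - v) U = sm u U \<otimes>\<^bsub>?A\<^esub> inv\<^bsub>?A\<^esub> sm v U"
    if u: "Poly_Mapping.keys u \<subseteq> carrier ?Q" and v: "Poly_Mapping.keys v \<subseteq> carrier ?Q"
      and U: "U \<in> carrier ?A" for u v U
  proof -
    have uv: "Poly_Mapping.keys (u - v) \<subseteq> carrier ?Q" using keys_diff[of u v] u v by blast
    have "sm u U = sm (u - v) U \<otimes>\<^bsub>?A\<^esub> sm v U"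
      using sm_add[OF uv v U] by simp
    then show ?thesis
      using sm_closed[OF u U] sm_closed[OF uv U] sm_closed[OF v U] by (simp add: A.inv_solve_right)
  qed
  have sm_mult: "sm u (U \<otimes>\<^bsub>?A\<^esub> V) = sm u U \<otimes>\<^bsub>?A\<^esub> sm u V"
    if u: "Poly_Mapping.keys u \<subseteq> carrier ?Q" and U: "U \<in> carrier ?A" and V: "V \<in> carrier ?A" for u U V
  proof -
    have *: "coset_conj G C U \<in> carrier ?A" "coset_conj G C V \<in> carrier ?A"
        "coset_conj G C (U \<otimes>\<^bsub>?A\<^esub> V) = coset_conj G C U \<otimes>\<^bsub>?A\<^esub> coset_conj G C V"
      if "C \<in> Poly_Mapping.keys u" for C
      using that u U V conj_closed conj_mult by auto
    have "sm u (U \<otimes>\<^bsub>?A\<^esub> V) = (\<Otimes>\<^bsub>?A\<^esub>C\<in>Poly_Mapping.keys u.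
        coset_conj G C U [^]\<^bsub>?A\<^esub> Poly_Mapping.lookup u C
        \<otimes>\<^bsub>?A\<^esub> coset_conj G C V [^]\<^bsub>?A\<^esub> Poly_Mapping.lookup u C)"
      unfolding sm_def
      by (intro A.finprod_cong')
        (auto simp: * A.int_pow_mult_distrib A.m_comm simp del: in_keys_iff)
    also have "\<dots> = sm u U \<otimes>\<^bsub>?A\<^esub> sm u V"
      unfolding sm_def by (intro A.finprod_multf) (auto simp: * simp del: in_keys_iff)
    finally show ?thesis .
  qed
  have sm_hom: "sm u \<in> hom ?A ?A" if "Poly_Mapping.keys u \<subseteq> carrier ?Q" for u
    using that by (auto simp: hom_def sm_closed sm_mult)
  have sm_inv: "sm u (inv\<^bsub>?A\<^esub> U) = inv\<^bsub>?A\<^esub> sm u U"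
    if "Poly_Mapping.keys u \<subseteq> carrier ?Q" "U \<in> carrier ?A" for u U
    using group_hom.hom_inv[of ?A ?A "sm u" U] that sm_hom
    by (simp add: group_hom_def group_hom_axioms_def A.is_group)

  define mul where "mul u v = u \<otimes>\<^bsub>?R\<^esub> v" for u v
  have mul_eq: "mul u v = frag_extend (\<lambda>a. frag_extend (\<lambda>b. frag_of (a \<otimes>\<^bsub>?Q\<^esub> b)) v) u" for u v
    by (simp add: mul_def group_ring_def)
  have mul_closed: "Poly_Mapping.keys (mul u v) \<subseteq> carrier ?Q"
    if "Poly_Mapping.keys u \<subseteq> carrier ?Q" "Poly_Mapping.keys v \<subseteq> carrier ?Q" for u v
    using R.m_closed[of u v] that by (simp add: group_ring_def mul_eq)
  have mul_diff_l: "mul (u - v) w = mul u w - mul v w" for u v w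
    by (simp add: mul_eq frag_extend_diff)
  have mul_diff_r: "mul (frag_of C) (v - w) = mul (frag_of C) v - mul (frag_of C) w" for C v w
    by (simp add: mul_eq frag_extend_diff)
  have sm_assoc1: "sm (mul (frag_of C) v) U = sm (frag_of C) (sm v U)"
    if C: "C \<in> carrier ?Q" and v: "Poly_Mapping.keys v \<subseteq> carrier ?Q" and U: "U \<in> carrier ?A" for C v U
  proof -
    have C': "Poly_Mapping.keys (frag_of C) \<subseteq> carrier ?Q" using C by simp
    have "Poly_Mapping.keys v \<subseteq> carrier ?Q \<and> sm (mul (frag_of C) v) U = sm (frag_of C) (sm v U)"
      using v
    proof (induction v rule: frag_induction)
      case zero
      have "sm (frag_of C) \<one>\<^bsub>?A\<^esub> = \<one>\<^bsub>?A\<^esub>"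
        using hom_one[OF sm_hom[OF C']] A.is_group by blast
      then show ?case by (simp add: mul_eq sm_0)
    next
      case (one C')
      then show ?case
        using C U by (simp add: mul_eq sm_of conj_conj conj_closed)
    next
      case (diff v w)
      then show ?case
        using keys_diff[of v w] C' U
        by (auto simp: mul_diff_r sm_diff mul_closed sm_mult sm_inv sm_closed)
    qed
    then show ?thesis by simp
  qed
  have sm_assoc: "sm (mul u v) U = sm u (sm v U)"
    if u: "Poly_Mapping.keys u \<subseteq> carrier ?Q" and v: "Poly_Mapping.keys v \<subseteq> carrier ?Q"
      and U: "U \<in> carrier ?A" for u v U
  proof -
    have "Poly_Mapping.keys u \<subseteq> carrier ?Q \<and> sm (mul u v) U = sm u (sm v U)"
      using u
    proof (induction u rule: frag_induction)
      case (diff u w)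
      then show ?case
        using keys_diff[of u w] v U
        by (auto simp: mul_diff_l sm_diff mul_closed sm_closed)
    next
      case zero
      show ?case by (simp add: mul_eq sm_0)
    next
      case (one C)
      then show ?case using v U by (simp add: sm_assoc1)
    qed
    then show ?thesis by simp
  qed

  have M [simp]: "carrier ?M = carrier ?A" "U \<oplus>\<^bsub>?M\<^esub> V = U \<otimes>\<^bsub>?A\<^esub> V" "\<zero>\<^bsub>?M\<^esub> = \<one>\<^bsub>?A\<^esub>"
      "u \<odot>\<^bsub>?M\<^esub> U = sm u U" for U V u
    by (simp_all add: relation_module_def sm_def)
  have R [simp]: "u \<in> carrier ?R \<longleftrightarrow> Poly_Mapping.keys u \<subseteq> carrier ?Q" "u \<oplus>\<^bsub>?R\<^esub> v = u + v"
      "\<one>\<^bsub>?R\<^esub> = frag_of \<one>\<^bsub>?Q\<^esub>" for u v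
    by (simp_all add: group_ring_def)
  have "abelian_group ?M"
    by (rule abelian_groupI) (simp_all add: A.m_ac)
  then show ?thesis
  proof (intro left_module.intro left_module_axioms.intro)
    show "\<one>\<^bsub>?R\<^esub> \<odot>\<^bsub>?M\<^esub> U = U" if "U \<in> carrier ?M" for U
      using that Q.one_closed by (simp only: M R sm_of conj_one)
  qed (simp_all add: R.ring_axioms sm_closed sm_add sm_mult sm_assoc mul_def[symmetric])
qed

section \<open>The presentation\<close>

definition rho :: "('a, 'b) monoid_scheme \<Rightarrow> nat \<Rightarrow> 'a \<Rightarrow> 'a \<Rightarrow> 'a" where
  "rho G k x t = (t \<otimes>\<^bsub>G\<^esub> x \<otimes>\<^bsub>G\<^esub> inv\<^bsub>G\<^esub> t) \<otimes>\<^bsub>G\<^esub> x \<otimes>\<^bsub>G\<^esub> inv\<^bsub>G\<^esub> (t \<otimes>\<^bsub>G\<^esub> x \<otimes>\<^bsub>G\<^esub> inv\<^bsub>G\<^esub> t)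
     \<otimes>\<^bsub>G\<^esub> x [^]\<^bsub>G\<^esub> (- int k - 1)"

datatype generator = Xm | Tm | Xn | Tn

abbreviation F :: "generator letter list monoid" where "F \<equiv> free_group"

abbreviation "xm \<equiv> free_gen Xm"
abbreviation "tm \<equiv> free_gen Tm"
abbreviation "xn \<equiv> free_gen Xn"
abbreviation "tn \<equiv> free_gen Tn"

definition relators :: "nat \<Rightarrow> nat \<Rightarrow> generator letter list set" where
  "relators m n = {rho F m xm tm, rho F n xn tn, xm [^]\<^bsub>F\<^esub> m, xn [^]\<^bsub>F\<^esub> n}"

definition relation_subgroup :: "nat \<Rightarrow> nat \<Rightarrow> generator letter list set" where
  "relation_subgroup m n = normal_closure F (relators m n)"

definition Gamma :: "nat \<Rightarrow> nat \<Rightarrow> generator letter list set monoid" where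
  "Gamma m n = F Mod relation_subgroup m n"

definition q :: "nat \<Rightarrow> nat" where
  "q k = (k + 1) ^ k - 1"

lemma (in group) rho_closed:
  "x \<in> carrier G \<Longrightarrow> t \<in> carrier G \<Longrightarrow> rho G k x t \<in> carrier G"
  by (simp add: rho_def)

lemma relation_subgroup_normal: "relation_subgroup m n \<lhd> F"
proof -
  interpret F: group F by (rule group_free_group)
  show ?thesis
    unfolding relation_subgroup_def
    by (rule F.normal_closure_normal) (auto simp: relators_def F.rho_closed free_gen_closed)
qed

lemma left_module_Gamma:
  "left_module (group_ring (Gamma m n)) (relation_module F (relation_subgroup m n))"
  unfolding Gamma_def
  by (intro group.left_module_relation_module group_free_group relation_subgroup_normal)

lemma relation_class_closed:
  "r \<in> relation_subgroup m n \<Longrightarrow>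
   relation_class F (relation_subgroup m n) r \<in> carrier (relation_module F (relation_subgroup m n))"
  using group.carrier_abelianisation[OF group_free_group]
  by (auto simp: relation_module_def relation_class_def)

lemma generators_in_relation_subgroup:
  "rho F m xm tm \<in> relation_subgroup m n"
  "rho F n xn tn \<in> relation_subgroup m n"
  "xm [^]\<^bsub>F\<^esub> m \<otimes>\<^bsub>F\<^esub> xn [^]\<^bsub>F\<^esub> n \<in> relation_subgroup m n"
proof -
  have "relators m n \<subseteq> relation_subgroup m n"
    by (simp add: relation_subgroup_def normal_closure_def hull_subset)
  moreover have "subgroup (relation_subgroup m n) F"
    using relation_subgroup_normal by (rule normal_imp_subgroup)
  ultimately show "rho F m xm tm \<in> relation_subgroup m n" "rho F n xn tn \<in> relation_subgroup m n"
      "xm [^]\<^bsub>F\<^esub> m \<otimes>\<^bsub>F\<^esub> xn [^]\<^bsub>F\<^esub> n \<in> relation_subgroup m n"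
    by (auto simp: relators_def intro: subgroup.m_closed)
qed

end

theory Submission
  imports Defs
begin

text \<open>
  Let \<open>S\<close> be a submodule of the relation module containing the three classes, and let \<open>K\<close> be its
  preimage in \<open>R\<close>: a normal subgroup of \<open>F\<close> with \<open>[R, R] \<subseteq> K \<subseteq> R\<close>.  In \<open>F / K\<close> put
  \<open>y = t x t\<inverse>\<close>.  The relator \<open>\<rho>\<^sub>k\<close> gives \<open>y x y\<inverse> = x\<^bsup>k+1\<^esup>\<close>, and so
  \<open>y\<^sup>k x\<^sup>k y\<^bsup>-k\<^esup> = (x\<^sup>k)\<^bsup>c\<^esup>\<close> with \<open>c = (k+1)\<^sup>k\<close>.  But \<open>x\<^sup>k\<close> and \<open>y\<^sup>k\<close> lie in the abelian
  group \<open>R / K\<close>, hence \<open>x\<^sup>k\<close> has order dividing \<open>q\<^sub>k\<close>.  As \<open>x\<^sub>m\<^sup>m\<close> and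
  \<open>x\<^sub>n\<^sup>n\<close> are mutually inverse in \<open>F / K\<close> and \<open>q\<^sub>m\<close>, \<open>q\<^sub>n\<close> are coprime, both are trivial, so
  \<open>K\<close> contains all relators.
\<close>

lemma (in group_hom) hom_rho:
  assumes "x \<in> carrier G" "t \<in> carrier G"
  shows "h (rho G k x t) = rho H k (h x) (h t)"
  using assms by (simp add: rho_def int_pow_closed hom_int_pow)

lemma (in group) pow_conj:
  assumes "x \<in> carrier G" "t \<in> carrier G"
  shows "(t \<otimes> x \<otimes> inv t) [^] (k::nat) = t \<otimes> x [^] k \<otimes> inv t"
proof (induction k)
  case (Suc k)
  then show ?case
    using assms by (simp add: m_assoc inv_cancel)
qed (use assms in simp)

text \<open>Conjugation respects powers, so each further conjugation by \<open>y\<close> multiplies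
  the exponent of \<open>x\<close> by \<open>c\<close>.\<close>

lemma (in group) conj_pow_eq_power:
  assumes x: "x \<in> carrier G" and y: "y \<in> carrier G" and conj: "y \<otimes> x \<otimes> inv y = x [^] (c::nat)"
  shows "y [^] (j::nat) \<otimes> x \<otimes> inv (y [^] j) = x [^] (c ^ j)"
proof (induction j)
  case (Suc j)
  have "y [^] Suc j \<otimes> x \<otimes> inv (y [^] Suc j) = y [^] j \<otimes> (y \<otimes> x \<otimes> inv y) \<otimes> inv (y [^] j)"
    using x y by (simp add: m_assoc inv_mult_group)
  also have "\<dots> = (y [^] j \<otimes> x \<otimes> inv (y [^] j)) [^] c"
    using x y by (simp add: conj pow_conj)
  also have "\<dots> = x [^] (c ^ Suc j)"
    using x by (simp add: Suc.IH nat_pow_pow mult.commute)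
  finally show ?case .
qed (use x in simp)

text \<open>Both factors in \<open>comm\<close> are conjugates of the relator
  \<open>x [^] k\<close>, so the hypothesis is available wherever conjugates of that relator
  commute. The first factor is also the \<open>k\<close>-th power of
  \<open>t \<otimes> x \<otimes> inv t\<close>, which links \<open>comm\<close> to the relation
  given by \<open>rho\<close>.\<close>

lemma (in group) rho_pow_torsion:
  assumes x: "x \<in> carrier G" and t: "t \<in> carrier G" and rho: "rho G k x t = \<one>"
    and comm: "(t \<otimes> x [^] k \<otimes> inv t) \<otimes> x [^] k = x [^] k \<otimes> (t \<otimes> x [^] k \<otimes> inv t)"
  shows "(x [^] k) [^] q k = \<one>"
proof -
  define y where "y = t \<otimes> x \<otimes> inv t"
  have y: "y \<in> carrier G" using x t by (simp add: y_def)
  have yk: "y [^] k = t \<otimes> x [^] k \<otimes> inv t" using x t by (simp add: y_def pow_conj)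
  have "x [^] (- int k - 1) = inv (x [^] (k + 1))"
  proof -
    have "- int k - 1 = - int (k + 1)" by simp
    then show ?thesis by (simp only: int_pow_neg_int[OF x])
  qed
  then have "y \<otimes> x \<otimes> inv y \<otimes> inv (x [^] (k + 1)) = \<one>"
    using rho by (simp only: rho_def y_def)
  then have "y \<otimes> x \<otimes> inv y = x [^] (k + 1)"
    using x y by (simp add: inv_solve_right' del: nat_pow_Suc)
  then have "y [^] k \<otimes> x \<otimes> inv (y [^] k) = x [^] ((k + 1) ^ k)"
    using x y by (rule conj_pow_eq_power[rotated 2])
  \<comment> \<open>Taking \<open>k\<close>-th powers inside the conjugation passes from
    \<open>x\<close> to \<open>x [^] k\<close>, to which \<open>comm\<close> applies.\<close>
  then have "y [^] k \<otimes> x [^] k \<otimes> inv (y [^] k) = (x [^] k) [^] ((k + 1) ^ k)"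
    using x y pow_conj[of x "y [^] k" k] by (simp add: nat_pow_pow mult.commute)
  moreover have "y [^] k \<otimes> x [^] k \<otimes> inv (y [^] k) = x [^] k"
    using comm x y by (simp add: yk[symmetric] m_assoc)
  \<comment> \<open>The natural subtraction in \<open>q\<close> does not truncate, as
    \<open>(k + 1) ^ k\<close> is positive.\<close>
  moreover have "(k + 1) ^ k = Suc (q k)" by (simp add: q_def)
  ultimately have "(x [^] k) [^] q k \<otimes> x [^] k = x [^] k" by simp
  then show ?thesis using x by simp
qed

lemma (in group) commute_of_commutator_eq_one:
  assumes "a \<in> carrier G" "b \<in> carrier G" "a \<otimes> b \<otimes> inv a \<otimes> inv b = \<one>"
  shows "a \<otimes> b = b \<otimes> a"
proof -
  have "a \<otimes> b \<otimes> inv a = b"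
    using assms inv_solve_right'[of \<one> "a \<otimes> b \<otimes> inv a" b] by simp
  then show ?thesis
    using assms(1,2) by (simp add: inv_solve_right')
qed

text \<open>The order of \<open>a\<close> divides both exponents. Infinite order, encoded as
  \<open>ord a = 0\<close>, would force \<open>i = j = 0\<close>, which is not a coprime
  pair.\<close>

lemma (in group) eq_one_of_coprime_pow:
  assumes a: "a \<in> carrier G" and "a [^] (i::nat) = \<one>" "a [^] (j::nat) = \<one>" "coprime i j"
  shows "a = \<one>"
proof -
  have "ord a dvd i" "ord a dvd j" using assms by (simp_all add: pow_eq_id)
  then have "ord a = 1" using \<open>coprime i j\<close> coprime_common_divisor_nat by blast
  then show ?thesis using a ord_eq_1 by blast
qed

text \<open>Taking classes is a homomorphism from \<open>N\<close> to the additive group of the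
  module, so \<open>K\<close> is a subgroup. Conjugation by \<open>g\<close> becomes multiplication
  by the basis element \<open>frag_of (N #> g)\<close>, so closure of \<open>S\<close> under scalars
  makes \<open>K\<close> normal in all of \<open>G\<close>. Elements of \<open>derived G N\<close>
  have class zero.\<close>

lemma (in group) normal_submodule_preimage:
  assumes N: "N \<lhd> G" and S: "submodule S (group_ring (G Mod N)) (relation_module G N)"
  defines "K \<equiv> {r \<in> N. relation_class G N r \<in> S}"
  shows "K \<lhd> G" and "derived G N \<subseteq> K"
proof -
  let ?M = "relation_module G N" and ?A = "abelianisation G N" and ?c = "relation_class G N"
  interpret N: normal N G by (rule N)
  interpret D: normal "derived G N" G by (rule derived_is_normal[OF N])
  interpret A: comm_group ?A
    by (rule derived_quot_of_subgroup_is_comm_group) (rule N.subgroup_axioms)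
  interpret M: left_module "group_ring (G Mod N)" ?M by (rule left_module_relation_module[OF N])
  interpret S: submodule S "group_ring (G Mod N)" ?M by (rule S)
  interpret GN: group "G\<lparr>carrier := N\<rparr>" by (rule N.subgroup_is_group[OF is_group])
  have add_group: "group (add_monoid ?M)"
    using M.a_comm_group by (simp add: comm_group_def)
  have c_mult: "?c (r \<otimes> s) = ?c r \<oplus>\<^bsub>?M\<^esub> ?c s" if "r \<in> N" "s \<in> N" for r s
    using mult_abelianisation[OF N that] by (simp add: relation_class_def relation_module_def)
  have c_carrier: "?c r \<in> carrier ?A" if "r \<in> N" for r
    using that by (auto simp: carrier_abelianisation relation_class_def)
  interpret c: group_hom "G\<lparr>carrier := N\<rparr>" "add_monoid ?M" ?c
  proof (intro group_hom.intro group_hom_axioms.intro GN.is_group add_group)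
    show "?c \<in> hom (G\<lparr>carrier := N\<rparr>) (add_monoid ?M)"
      using c_carrier c_mult by (auto simp: hom_def relation_module_def)
  qed
  have c_conj: "?c (g \<otimes> r \<otimes> inv g) = frag_of (N #> g) \<odot>\<^bsub>?M\<^esub> ?c r"
    if "g \<in> carrier G" "r \<in> N" for g r
  proof -
    have "coset_conj G (N #> g) (?c r) = ?c (g \<otimes> r \<otimes> inv g)"
      using coset_conj_rcos[OF N that] by (simp add: relation_class_def)
    moreover have "?c (g \<otimes> r \<otimes> inv g) \<in> carrier ?A"
      using that by (intro c_carrier N.inv_op_closed2)
    ultimately show ?thesis
      by (simp add: relation_module_def del: mult_FactGroup one_FactGroup)
  qed
  have S_add: "subgroup S (add_monoid ?M)" by (rule S.subgroup_axioms)
  have c_one: "?c \<one> = \<zero>\<^bsub>?M\<^esub>" using c.hom_one by simp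
  have "subgroup K G"
  proof (rule subgroupI)
    show "K \<subseteq> carrier G" using N.subset by (auto simp: K_def)
    have "\<one> \<in> K" using subgroup.one_closed[OF S_add] c_one by (simp add: K_def)
    then show "K \<noteq> {}" by blast
    show "inv r \<in> K" if "r \<in> K" for r
    proof -
      have r: "r \<in> N" "?c r \<in> S" using that by (auto simp: K_def)
      then have "?c (inv\<^bsub>G\<lparr>carrier := N\<rparr>\<^esub> r) \<in> S"
        using c.hom_inv[of r] subgroup.m_inv_closed[OF S_add] by simp
      then show ?thesis
        using r N.subgroup_axioms by (simp add: K_def m_inv_consistent)
    qed
    show "r \<otimes> s \<in> K" if "r \<in> K" "s \<in> K" for r s
      using that subgroup.m_closed[OF S_add] by (auto simp: K_def c_mult)
  qed
  moreover have "g \<otimes> r \<otimes> inv g \<in> K" if "g \<in> carrier G" "r \<in> K" for g r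
  proof -
    have "N #> g \<in> carrier (G Mod N)" using that by (auto simp: FactGroup_def RCOSETS_def)
    then have "frag_of (N #> g) \<in> carrier (group_ring (G Mod N))" by (simp add: group_ring_def)
    then show ?thesis
      using that S.smult_closed by (auto simp: K_def c_conj N.inv_op_closed2)
  qed
  ultimately show "K \<lhd> G" by (simp add: normal_inv_iff)
  show "derived G N \<subseteq> K"
  proof
    fix d assume d: "d \<in> derived G N"
    have "?c d = derived G N" using d by (simp add: relation_class_def D.rcos_const)
    also have "\<dots> = ?c \<one>" by (simp add: relation_class_def D.subset)
    finally have "?c d \<in> S" using subgroup.one_closed[OF S_add] c_one by simp
    then show "d \<in> K"
      using d derived_incl[OF _ N.subgroup_axioms] by (auto simp: K_def)
  qed
qed

text \<open>By minimality of the normal closure it suffices that \<open>K\<close> contains the two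
  power relators, that is, that they become trivial in \<open>F Mod K\<close>.\<close>

lemma relation_subgroup_subset:
  assumes K: "K \<lhd> F" and derived: "derived F (relation_subgroup m n) \<subseteq> K"
    and coprime: "coprime (q m) (q n)"
    and rho: "rho F m xm tm \<in> K" "rho F n xn tn \<in> K"
    and prod: "xm [^]\<^bsub>F\<^esub> m \<otimes>\<^bsub>F\<^esub> xn [^]\<^bsub>F\<^esub> n \<in> K"
  shows "relation_subgroup m n \<subseteq> K"
proof -
  let ?R = "relation_subgroup m n" and ?H = "F Mod K"
  interpret F: group F by (rule group_free_group)
  interpret K: normal K F by (rule K)
  interpret R: normal ?R F by (rule relation_subgroup_normal)
  interpret H: group ?H by (rule K.factorgroup_is_group)
  define h where "h u = K #>\<^bsub>F\<^esub> u" for u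
  interpret h: group_hom F ?H h
    using K.r_coset_hom_Mod by unfold_locales (simp add: h_def[abs_def])
  have h_one: "h u = \<one>\<^bsub>?H\<^esub> \<longleftrightarrow> u \<in> K" if "u \<in> carrier F" for u
    using that K.rcos_const F.coset_join1[OF _ _ K.subgroup_axioms] by (auto simp: h_def K.subset)
  \<comment> \<open>The image of \<open>?R\<close> in the quotient is abelian because
    \<open>K\<close> contains its commutators.\<close>
  have comm: "h r \<otimes>\<^bsub>?H\<^esub> h s = h s \<otimes>\<^bsub>?H\<^esub> h r" if "r \<in> ?R" "s \<in> ?R" for r s
  proof -
    have "r \<otimes>\<^bsub>F\<^esub> s \<otimes>\<^bsub>F\<^esub> inv\<^bsub>F\<^esub> r \<otimes>\<^bsub>F\<^esub> inv\<^bsub>F\<^esub> s \<in> derived F ?R"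
      unfolding derived_def using that by (intro generate.incl) auto
    then have "h (r \<otimes>\<^bsub>F\<^esub> s \<otimes>\<^bsub>F\<^esub> inv\<^bsub>F\<^esub> r \<otimes>\<^bsub>F\<^esub> inv\<^bsub>F\<^esub> s) = \<one>\<^bsub>?H\<^esub>"
      using derived that by (subst h_one) auto
    then have "h r \<otimes>\<^bsub>?H\<^esub> h s \<otimes>\<^bsub>?H\<^esub> inv\<^bsub>?H\<^esub> h r \<otimes>\<^bsub>?H\<^esub> inv\<^bsub>?H\<^esub> h s = \<one>\<^bsub>?H\<^esub>"
      using that by (simp del: mult_FactGroup one_FactGroup)
    then show ?thesis
      using that by (intro H.commute_of_commutator_eq_one) simp_all
  qed
  have torsion: "h (x [^]\<^bsub>F\<^esub> k) [^]\<^bsub>?H\<^esub> q k = \<one>\<^bsub>?H\<^esub>"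
    if "x \<in> carrier F" "t \<in> carrier F" "rho F k x t \<in> K" "x [^]\<^bsub>F\<^esub> k \<in> ?R" for k x t
  proof -
    have "rho ?H k (h x) (h t) = \<one>\<^bsub>?H\<^esub>"
      using h.hom_rho[OF that(1,2)] h_one[OF F.rho_closed[OF that(1,2)]] that(3)
      by (simp only: simp_thms)
    moreover have "h (t \<otimes>\<^bsub>F\<^esub> x [^]\<^bsub>F\<^esub> k \<otimes>\<^bsub>F\<^esub> inv\<^bsub>F\<^esub> t) = h t \<otimes>\<^bsub>?H\<^esub> h x [^]\<^bsub>?H\<^esub> k \<otimes>\<^bsub>?H\<^esub> inv\<^bsub>?H\<^esub> h t"
      using that by (simp add: h.hom_nat_pow del: mult_FactGroup)
    moreover have "h (x [^]\<^bsub>F\<^esub> k) = h x [^]\<^bsub>?H\<^esub> k"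
      using that by (simp add: h.hom_nat_pow)
    \<comment> \<open>Normality of \<open>?R\<close> lets \<open>comm\<close> apply to
      \<open>x [^] k\<close> and its conjugate by \<open>t\<close>.\<close>
    moreover have "t \<otimes>\<^bsub>F\<^esub> x [^]\<^bsub>F\<^esub> k \<otimes>\<^bsub>F\<^esub> inv\<^bsub>F\<^esub> t \<in> ?R"
      using that by (intro R.inv_op_closed2)
    ultimately show ?thesis
      using H.rho_pow_torsion[OF h.hom_closed h.hom_closed, OF that(1,2)] comm that(4) by metis
  qed
  have gen: "free_gen g \<in> carrier F" for g by (rule free_gen_closed)
  let ?a = "xm [^]\<^bsub>F\<^esub> m" and ?b = "xn [^]\<^bsub>F\<^esub> n"
  have rel: "?a \<in> ?R" "?b \<in> ?R"
    using hull_subset[of "relators m n"]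
    by (auto simp: relation_subgroup_def normal_closure_def relators_def)
  have ha: "h ?a [^]\<^bsub>?H\<^esub> q m = \<one>\<^bsub>?H\<^esub>" and hb: "h ?b [^]\<^bsub>?H\<^esub> q n = \<one>\<^bsub>?H\<^esub>"
    by (rule torsion[OF gen gen rho(1) rel(1)], rule torsion[OF gen gen rho(2) rel(2)])
  have "h ?a \<otimes>\<^bsub>?H\<^esub> h ?b = \<one>\<^bsub>?H\<^esub>"
    using prod h_one gen by (simp flip: h.hom_mult del: mult_FactGroup one_FactGroup)
  then have inv: "h ?a = inv\<^bsub>?H\<^esub> h ?b"
    using gen by (intro H.inv_equality[symmetric]) simp_all
  \<comment> \<open>Being inverse to \<open>h ?b\<close>, the element \<open>h ?a\<close> is also
    killed by the exponent \<open>q n\<close>.\<close>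
  have "h ?a [^]\<^bsub>?H\<^esub> q n = \<one>\<^bsub>?H\<^esub>"
    unfolding inv using hb gen by (simp add: H.nat_pow_inv del: mult_FactGroup one_FactGroup)
  then have "h ?a = \<one>\<^bsub>?H\<^esub>"
    using ha coprime gen F.nat_pow_closed h.hom_closed H.eq_one_of_coprime_pow[of "h ?a" "q m" "q n"] by blast
  moreover from this have "h ?b = \<one>\<^bsub>?H\<^esub>"
    using inv gen by (simp del: one_FactGroup)
  ultimately have "?a \<in> K" "?b \<in> K" using h_one gen F.nat_pow_closed by blast+
  then have "relators m n \<subseteq> K" using rho by (simp add: relators_def)
  then show ?thesis
    unfolding relation_subgroup_def normal_closure_def using K by (intro hull_minimal)
qed

theorem proposition3p3:
  fixes m n :: nat
  assumes "m \<ge> 1" and "n \<ge> 1" and "coprime (q m) (q n)"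
  shows "submodule_span (group_ring (Gamma m n)) (relation_module F (relation_subgroup m n))
      {relation_class F (relation_subgroup m n) (rho F m xm tm),
       relation_class F (relation_subgroup m n) (rho F n xn tn),
       relation_class F (relation_subgroup m n) (xm [^]\<^bsub>F\<^esub> m \<otimes>\<^bsub>F\<^esub> xn [^]\<^bsub>F\<^esub> n)}
    = carrier (relation_module F (relation_subgroup m n))"
    (is "submodule_span ?Z ?M ?T = _")
proof -
  let ?R = "relation_subgroup m n"
  define S where "S = submodule_span ?Z ?M ?T"
  define K where "K = {r \<in> ?R. relation_class F ?R r \<in> S}"
  have T: "?T \<subseteq> carrier ?M"
    by (simp add: relation_class_closed generators_in_relation_subgroup)
  have S: "submodule S ?Z ?M"
    unfolding S_def using left_module_Gamma T by (rule left_module.submodule_submodule_span)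
  note K_normal = group.normal_submodule_preimage[OF group_free_group relation_subgroup_normal
      S[unfolded Gamma_def], folded K_def]
  have "?T \<subseteq> S" by (simp only: S_def submodule_span_def hull_subset)
  \<comment> \<open>The three generating classes lie in \<open>S\<close>, so their representatives
    lie in \<open>K\<close>.\<close>
  then have "?R \<subseteq> K"
    using generators_in_relation_subgroup assms
    by (intro relation_subgroup_subset K_normal) (auto simp: K_def)
  \<comment> \<open>Every module element is the class of some \<open>r\<close> in \<open>?R\<close>,
    and membership in \<open>K\<close> puts that class in \<open>S\<close>.\<close>
  then have "carrier ?M \<subseteq> S"
    using group.carrier_abelianisation[OF group_free_group, of ?R]
    by (auto simp: K_def relation_module_def relation_class_def)
  moreover have "S \<subseteq> carrier ?M"
    using S subgroup.subset[of S "add_monoid ?M"] by (simp add: submodule_def)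
  ultimately show ?thesis by (simp add: S_def)
qed

end
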